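(* Let $K$ be a martingale kernel on $(0,\infty)$ and, for $x>0$, let $S=(S_k)_{k\in\mathbb{N}_0}$ be under $\mathbb{P}_x$ the positive Markov martingale with transition kernel $K$ started from $S_0=x$. Let $$b(x):=\mathbb{E}_x\Big[\frac{S_1}{x}\mathbf{1}_{\{S_1<x\}}\Big]=\int_{(0,x)}\frac{y}{x}\,K(x,\mathrm{d}y),\quad x>0.$$ Assume that $\liminf_{x\to\infty}b(x)>0$. Then $S$ fails to be a bubble under $\mathbb{P}_x$ for any $x\in(0,\infty)$.
   Context: Martingale kernel: $K:(0,\infty)\times\mathcal{B}_{(0,\infty)}\to[0,\infty)$ is a Markov (probability) kernel on $(0,\infty)$ with $\int_{(0,\infty)}y\,K(x,\mathrm{d}y)=x$ for all $x>0$. For $x>0$, under $\mathbb{P}_x$ (with expectation $\mathbb{E}_x$) the process $S=(S_k)_{k\in\mathbb{N}_0}$ is the time-homogeneous Markov chain with $S_0=x$ and transition kernel $K$; it is a positive martingale, with $\mathbb{P}_x$-a.s. limit $S_\infty$. Definition (bubble): put $\tau_0:=0$ and $\tau_k:=\inf\{j>\tau_{k-1}: S_j<S_{j-1}\}$ for $k\in\mathbb{N}$ ($\inf\emptyset=\infty$), and $S_{\tau_k}:=S_\infty$ on $\{\tau_k=\infty\}$. $S$ is a bubble under $\mathbb{P}_x$ (equivalently $\mathbb{P}_x$ is a bubble measure for $S$) if $\mathbb{E}_x[S_{\tau_k}]<\mathbb{E}_x[S_0]=x$ for some $k\in\mathbb{N}$. *)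

theory Defs
  imports "HOL-Probability.Probability" "HOL-Library.Extended_Nat"
begin

definition pos_borel :: "real measure" where
  "pos_borel = restrict_space borel {0<..}"

text \<open>Only the values of a kernel at points of \<open>(0,\<infinity>)\<close> are ever constrained or used;
  what \<open>K\<close> is at non-positive arguments is irrelevant.\<close>

definition martingale_kernel :: "(real \<Rightarrow> real measure) \<Rightarrow> bool" where
  "martingale_kernel K \<longleftrightarrow>
     K \<in> pos_borel \<rightarrow>\<^sub>M prob_algebra pos_borel \<and>
     (\<forall>x>0. integrable (K x) (\<lambda>y. y) \<and> (\<integral>y. y \<partial>K x) = x)"

definition natural_filtration ::
    "'w measure \<Rightarrow> 'a measure \<Rightarrow> (nat \<Rightarrow> 'w \<Rightarrow> 'a) \<Rightarrow> nat \<Rightarrow> 'w measure" where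
  "natural_filtration M N S n =
     vimage_algebra (space M) (\<lambda>\<omega>. \<lambda>i\<in>{..n}. S i \<omega>) (Pi\<^sub>M {..n} (\<lambda>_. N))"

text \<open>\<open>M\<close> plays the role of \<open>\<P>\<^sub>x\<close>. Any realisation of the chain is admitted, not just the
  canonical one on path space.\<close>

definition markov_chain ::
    "'w measure \<Rightarrow> 'a measure \<Rightarrow> ('a \<Rightarrow> 'a measure) \<Rightarrow> 'a \<Rightarrow> (nat \<Rightarrow> 'w \<Rightarrow> 'a) \<Rightarrow> bool" where
  "markov_chain M N K x S \<longleftrightarrow>
     prob_space M \<and>
     (\<forall>n. S n \<in> M \<rightarrow>\<^sub>M N) \<and>
     (AE \<omega> in M. S 0 \<omega> = x) \<and>
     (\<forall>n. \<forall>B\<in>sets N. AE \<omega> in M.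
        real_cond_exp M (natural_filtration M N S n) (\<lambda>\<omega>. indicator B (S (Suc n) \<omega>)) \<omega>
          = measure (K (S n \<omega>)) B)"

text \<open>Times of successive downward moves of a path. The infimum is taken in \<^typ>\<open>enat\<close>, so that
  \<open>Inf {} = \<infinity>\<close>; the truncated subtraction is harmless since \<open>j > 0\<close> in the set.\<close>

primrec drop_time :: "(nat \<Rightarrow> real) \<Rightarrow> nat \<Rightarrow> enat" where
  "drop_time s 0 = 0"
| "drop_time s (Suc k) = Inf {enat j | j. drop_time s k < enat j \<and> s j < s (j - 1)}"

text \<open>The value at time \<open>\<infinity>\<close> is the limit of the path; where the path diverges, \<^const>\<open>lim\<close>
  is an unspecified real, which for a positive martingale concerns only a null set.\<close>

definition value_at :: "(nat \<Rightarrow> real) \<Rightarrow> enat \<Rightarrow> real" where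
  "value_at s t = (case t of enat j \<Rightarrow> s j | \<infinity> \<Rightarrow> lim s)"

text \<open>The random variables are (almost surely) nonnegative, so the expectations are taken as
  Lebesgue integrals in \<open>[0,\<infinity>]\<close>, which need no integrability assumption.\<close>

definition bubble :: "'w measure \<Rightarrow> (nat \<Rightarrow> 'w \<Rightarrow> real) \<Rightarrow> bool" where
  "bubble M S \<longleftrightarrow>
     (\<exists>k\<ge>1. (\<integral>\<^sup>+ \<omega>. ennreal (value_at (\<lambda>n. S n \<omega>) (drop_time (\<lambda>n. S n \<omega>) k)) \<partial>M)
              < (\<integral>\<^sup>+ \<omega>. ennreal (S 0 \<omega>) \<partial>M))"

definition drop_mean :: "(real \<Rightarrow> real measure) \<Rightarrow> real \<Rightarrow> real" where
  "drop_mean K x = (LINT y:{0<..<x}|K x. y / x)"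

end

theory Submission
  imports Defs
begin

text \<open>By optional stopping at \<open>\<tau>\<^sub>k \<and> n\<close>, a bubble can only arise from mass \<open>E[S\<^sub>n; \<tau>\<^sub>k > n, S\<^sub>n > a]\<close> that
  does not vanish as \<open>n \<rightarrow> \<infinity>\<close>: the truncated mass \<open>E[S\<^sub>n; \<tau>\<^sub>k > n, S\<^sub>n \<le> a]\<close> converges by dominated
  convergence. Choose \<open>a\<close> and \<open>\<epsilon> > 0\<close> such that \<open>b \<ge> \<epsilon>\<close> above \<open>a\<close>. Under the change of measure with
  density \<open>S\<^sub>n\<close>, a step from above \<open>a\<close> is a drop with probability at least \<open>\<epsilon>\<close>. Hence, for each number
  of drops, the mass above \<open>a\<close> shrinks geometrically apart from summable inflow, and it tends
  to \<open>0\<close>.\<close>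

section \<open>Counting downward moves of a path\<close>

text \<open>Counting process dual to \<open>drop_time\<close>: its value at \<open>n\<close> depends
  only on the path up to \<open>n\<close>, so events about drop times become visibly
  adapted.\<close>

primrec drops :: "(nat \<Rightarrow> real) \<Rightarrow> nat \<Rightarrow> nat" where
  "drops s 0 = 0"
| "drops s (Suc n) = drops s n + (if s (Suc n) < s n then 1 else 0)"

lemma mono_drops: "mono (drops s)"
  by (simp add: mono_iff_le_Suc)

text \<open>Mirrors the recursion of \<open>drop_time\<close>, which prepares the induction on
  \<open>k\<close> in the next lemma.\<close>

lemma Suc_le_drops_iff:
  "Suc k \<le> drops s n \<longleftrightarrow> (\<exists>j<n. k \<le> drops s j \<and> s (Suc j) < s j)"
  by (induction n) (auto simp: less_Suc_eq)

lemma drop_time_le_iff: "drop_time s k \<le> enat n \<longleftrightarrow> k \<le> drops s n"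
proof (induction k arbitrary: n)
  case 0
  show ?case by (simp flip: zero_enat_def)
next
  case (Suc k)
  let ?A = "{enat j |j. drop_time s k < enat j \<and> s j < s (j - 1)}"
  \<comment> \<open>Being strictly before \<open>Suc i\<close> means being at most \<open>i\<close>,
    so the induction hypothesis applies at \<open>j - 1\<close>.\<close>
  have less_iff: "drop_time s k < enat j \<longleftrightarrow> j > 0 \<and> k \<le> drops s (j - 1)" for j
  proof (cases j)
    case 0
    then show ?thesis by (simp flip: zero_enat_def)
  next
    case (Suc i)
    have "drop_time s k < enat (Suc i) \<longleftrightarrow> drop_time s k \<le> enat i"
      by (cases "drop_time s k") (auto simp: less_Suc_eq_le)
    then show ?thesis using Suc.IH Suc by simp
  qed
  \<comment> \<open>An infimum in \<open>enat\<close> is attained unless the set is empty, and then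
    it is infinite and exceeds \<open>n\<close>.\<close>
  have "Inf ?A \<le> enat n \<longleftrightarrow> (\<exists>a\<in>?A. a \<le> enat n)"
  proof
    assume *: "Inf ?A \<le> enat n"
    have "?A \<noteq> {}"
    proof
      assume "?A = {}"
      with * show False by (simp only:) (simp add: Inf_enat_def)
    qed
    then have "Inf ?A \<in> ?A" unfolding Inf_enat_def by (auto intro: LeastI)
    with * show "\<exists>a\<in>?A. a \<le> enat n" by blast
  qed (meson Inf_lower order_trans)
  also have "\<dots> \<longleftrightarrow> (\<exists>j\<le>n. j > 0 \<and> k \<le> drops s (j - 1) \<and> s j < s (j - 1))"
    using less_iff by auto
  also have "\<dots> \<longleftrightarrow> (\<exists>j<n. k \<le> drops s j \<and> s (Suc j) < s j)"
    by (metis Suc_leI Suc_pred' diff_Suc_1 less_eq_Suc_le zero_less_Suc)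
  finally show ?case by (simp add: Suc_le_drops_iff)
qed

text \<open>The count is monotone, so equal counts at the ends exclude every drop in
  between.\<close>

lemma drops_eq_imp_le:
  assumes "n \<le> m" "drops s n = drops s m"
  shows "s n \<le> s m"
  using assms
proof (induction m rule: dec_induct)
  case (step m)
  have "drops s n \<le> drops s m" using step.hyps by (auto intro!: monoD[OF mono_drops])
  then have "drops s n = drops s m" "s m \<le> s (Suc m)"
    using step.prems by (simp_all split: if_splits)
  with step.IH show ?case by simp
qed simp

declare drops.simps(2) [simp del]

text \<open>A bounded count attains its maximum at some \<open>n0\<close> and is constant
  afterwards.\<close>

lemma drops_less_imp_incseq:
  assumes "\<And>n. drops s n < k"
  obtains n0 where "incseq (\<lambda>n. s (n + n0))"
proof -
  have fin: "finite (range (drops s))"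
    by (rule finite_subset[of _ "{..<k}"]) (use assms in auto)
  have "Max (range (drops s)) \<in> range (drops s)" using fin by (intro Max_in) auto
  then obtain n0 where n0: "Max (range (drops s)) = drops s n0" by blast
  have const: "drops s n = drops s n0" if "n \<ge> n0" for n
    using monoD[OF mono_drops that, of s] Max_ge[OF fin rangeI[of "drops s" n]] n0 by simp
  have "incseq (\<lambda>n. s (n + n0))"
    by (intro incseq_SucI drops_eq_imp_le) (simp, metis const le_add2)
  then show thesis by (rule that)
qed

text \<open>A path with finitely many drops is eventually nondecreasing. Hence it converges unless it
  exceeds every level \<open>a\<close>, in which case the truncated path vanishes eventually. This makes
  martingale convergence superfluous.\<close>

lemma truncated_path_limit:
  fixes s :: "nat \<Rightarrow> real"
  assumes "\<And>n. s n > 0" "k \<ge> 1"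
  shows "\<exists>l. (\<lambda>n. ennreal (s n) * indicator {n. drops s n < k \<and> s n \<le> a} n) \<longlonglongrightarrow> l \<and>
     (\<Sum>i. ennreal (s (Suc i)) * indicator {i. drops s i < k \<and> k \<le> drops s (Suc i)} i) + l
       \<le> ennreal (value_at s (drop_time s k))" (is "\<exists>l. ?f \<longlonglongrightarrow> l \<and> (\<Sum>i. ?g i) + l \<le> _")
proof (cases "drop_time s k")
  case (enat t)
  have iff: "k \<le> drops s n \<longleftrightarrow> t \<le> n" for n
    using drop_time_le_iff[of s k n] enat by simp
  have "t \<noteq> 0" using iff[of 0] assms by auto
  then obtain u where u: "t = Suc u" by (cases t) auto
  \<comment> \<open>The \<open>k\<close>-th drop is the step from \<open>u\<close> to
    \<open>t\<close>, so the series has a single term, the stopped value \<open>s t\<close>. The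
    truncated path vanishes from \<open>t\<close> on.\<close>
  have g: "?g i = (if i = u then ennreal (s t) else 0)" for i
    using iff[of i] iff[of "Suc i"] u by (auto simp: indicator_def not_le[symmetric])
  have "(\<Sum>i. ?g i) = (\<Sum>i\<in>{u}. ?g i)"
    by (rule suminf_finite) (use g in auto)
  then have "(\<Sum>i. ?g i) = ennreal (s t)" using g[of u] by simp
  moreover have "?f \<longlonglongrightarrow> 0"
  proof (rule tendsto_eventually, rule eventually_sequentiallyI)
    fix n assume "n \<ge> t"
    then show "?f n = 0" using iff[of n] by (auto simp: indicator_def)
  qed
  ultimately show ?thesis using enat by (auto simp: value_at_def)
next
  case infinity
  have less: "drops s n < k" for n
    using drop_time_le_iff[of s k n] infinity by simp
  have "?g = (\<lambda>_. 0)" using less by (auto simp: indicator_def not_le[symmetric])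
  then have g: "(\<Sum>i. ?g i) = 0" by simp
  obtain n0 where n0: "incseq (\<lambda>n. s (n + n0))" using drops_less_imp_incseq[OF less] .
  have mono: "s n \<le> s m" if "n0 \<le> n" "n \<le> m" for n m
    using incseqD[OF n0, of "n - n0" "m - n0"] that by simp
  show ?thesis
  proof (cases "\<exists>n\<ge>n0. s n > a")
    \<comment> \<open>The limit \<open>l = 0\<close> suffices here whatever \<open>lim s\<close> is,
      even an unspecified real, because \<open>ennreal\<close> is never negative.\<close>
    case True
    then obtain n1 where n1: "n1 \<ge> n0" "s n1 > a" by blast
    have "?f \<longlonglongrightarrow> 0"
    proof (rule tendsto_eventually, rule eventually_sequentiallyI)
      fix n assume "n \<ge> n1"
      then show "?f n = 0" using mono[of n1 n] n1 by (auto simp: indicator_def)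
    qed
    then show ?thesis using g by auto
  next
    case False
    then have le: "s n \<le> a" if "n \<ge> n0" for n using that by force
    obtain L where L: "(\<lambda>n. s (n + n0)) \<longlonglongrightarrow> L"
      using incseq_convergent[OF n0, of a] le by (metis le_add2)
    then have sL: "s \<longlonglongrightarrow> L" by (rule LIMSEQ_offset)
    have "(\<lambda>n. ennreal (s n)) \<longlonglongrightarrow> ennreal L" using sL by (rule tendsto_ennrealI)
    then have "?f \<longlonglongrightarrow> ennreal L"
      by (rule Lim_transform_eventually)
        (auto intro!: eventually_sequentiallyI[of n0] simp: indicator_def less le)
    then show ?thesis using g infinity limI[OF sL] by (auto simp: value_at_def)
  qed
qed

text \<open>Summing the recursion bounds a partial sum \<open>t\<close> by \<open>c + q * t\<close>.
  Solving for \<open>t\<close> gives the bound \<open>c / (1 - q)\<close>, uniformly in the number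
  of terms.\<close>

lemma suminf_finite_of_contraction:
  fixes m e :: "nat \<Rightarrow> ennreal"
  assumes fin: "\<And>n. m n < \<infinity>" and q: "0 \<le> q" "q < 1"
    and step: "\<And>n. m (Suc n) \<le> ennreal q * m n + e n"
    and e: "(\<Sum>n. e n) < \<infinity>"
  shows "(\<Sum>n. m n) < \<infinity>"
proof -
  define C where "C = m 0 + (\<Sum>n. e n)"
  have "C < \<infinity>" using fin e by (simp add: C_def)
  then obtain c where c: "C = ennreal c" "c \<ge> 0" by (cases C) auto
  have "(\<Sum>n<N. m n) \<le> ennreal (c / (1 - q))" for N
  proof -
    \<comment> \<open>Finiteness permits passing to reals, where \<open>q * t\<close> can be
      subtracted.\<close>
    have "(\<Sum>n<N. m n) < \<infinity>" using fin by simp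
    then obtain t where t: "(\<Sum>n<N. m n) = ennreal t" "t \<ge> 0" by (cases "\<Sum>n<N. m n") auto
    have "(\<Sum>n<N. m n) \<le> (\<Sum>n<Suc N. m n)" by simp
    also have "\<dots> = m 0 + (\<Sum>n<N. m (Suc n))" by (rule sum.lessThan_Suc_shift)
    also have "\<dots> \<le> m 0 + (\<Sum>n<N. ennreal q * m n + e n)"
      by (intro add_left_mono sum_mono step)
    also have "\<dots> = m 0 + (\<Sum>n<N. e n) + ennreal q * (\<Sum>n<N. m n)"
      by (simp add: sum.distrib sum_distrib_left ac_simps)
    also have "\<dots> \<le> C + ennreal q * (\<Sum>n<N. m n)"
      unfolding C_def by (intro add_mono order_refl sum_le_suminf) auto
    finally have "t \<le> c + q * t"
      using t c q by (simp flip: ennreal_mult' ennreal_plus)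
    then have "t \<le> c / (1 - q)" using q by (simp add: field_simps)
    then show ?thesis using t by (simp add: ennreal_leI)
  qed
  then have "(\<Sum>n. m n) \<le> ennreal (c / (1 - q))" by (intro suminf_le_const) auto
  then show ?thesis using le_less_trans[OF _ ennreal_less_top] by simp
qed

section \<open>Chains with a martingale kernel\<close>

locale martingale_chain =
  fixes K :: "real \<Rightarrow> real measure" and M :: "'w measure" and x :: real
    and S :: "nat \<Rightarrow> 'w \<Rightarrow> real"
  assumes kernel: "martingale_kernel K" and chain: "markov_chain M pos_borel K x S"
begin

section \<open>Measurability and the natural filtration\<close>

abbreviation "F \<equiv> natural_filtration M pos_borel S"

lemma space_pos_borel: "space pos_borel = {0<..}"
  by (simp add: pos_borel_def space_restrict_space)

lemma borel_measurable_pos_borel: "f \<in> borel_measurable borel \<Longrightarrow> f \<in> borel_measurable pos_borel"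
  by (simp add: pos_borel_def measurable_restrict_space1)

lemma kernel_measurable [measurable]: "K \<in> pos_borel \<rightarrow>\<^sub>M subprob_algebra pos_borel"
  using kernel by (simp add: martingale_kernel_def measurable_prob_algebraD)

lemma K_prob: "y > 0 \<Longrightarrow> prob_space (K y)" and sets_K: "y > 0 \<Longrightarrow> sets (K y) = sets pos_borel"
proof -
  assume "y > 0"
  then have "K y \<in> space (prob_algebra pos_borel)"
    using kernel measurable_space[of K pos_borel "prob_algebra pos_borel" y]
    by (simp add: martingale_kernel_def space_pos_borel)
  then show "prob_space (K y)" "sets (K y) = sets pos_borel"
    by (auto simp: space_prob_algebra)
qed

sublocale prob_space M
  using chain by (simp add: markov_chain_def)

lemma S_measurable' [measurable]: "S n \<in> M \<rightarrow>\<^sub>M pos_borel"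
  using chain by (simp add: markov_chain_def)

lemma S_borel [measurable]: "S n \<in> borel_measurable M"
  using measurable_compose[OF S_measurable' borel_measurable_pos_borel[of "\<lambda>x. x"]] by simp

lemma S_pos: "\<omega> \<in> space M \<Longrightarrow> S n \<omega> > 0"
  using measurable_space[OF S_measurable'] by (auto simp: space_pos_borel)

lemma space_F [simp]: "space (F n) = space M"
  by (simp add: natural_filtration_def)

lemma S_F': "i \<le> n \<Longrightarrow> S i \<in> F n \<rightarrow>\<^sub>M pos_borel"
proof -
  assume "i \<le> n"
  have "(\<lambda>\<omega>. \<lambda>i\<in>{..n}. S i \<omega>) \<in> F n \<rightarrow>\<^sub>M Pi\<^sub>M {..n} (\<lambda>_. pos_borel)"
    unfolding natural_filtration_def
    by (rule measurable_vimage_algebra1) (auto simp: space_PiM space_pos_borel S_pos)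
  from measurable_compose[OF this measurable_component_singleton[of i]] \<open>i \<le> n\<close>
  show ?thesis by simp
qed

text \<open>Minimality among sigma-algebras that make the first coordinates measurable. Taking
  \<open>M\<close> for \<open>A\<close> gives the subalgebra property, and taking \<open>F m\<close>
  gives monotonicity in time.\<close>

lemma F_minimal:
  assumes "space A = space M" "\<And>i. i \<le> n \<Longrightarrow> S i \<in> A \<rightarrow>\<^sub>M pos_borel"
  shows "sets (F n) \<subseteq> sets A"
  unfolding natural_filtration_def using assms
  by (intro sets_image_in_sets measurable_restrict) auto

lemma F_subalgebra: "subalgebra M (F n)"
  by (simp add: subalgebra_def F_minimal)

lemma F_sets: "A \<in> sets (F n) \<Longrightarrow> A \<in> sets M"
  using F_subalgebra by (auto simp: subalgebra_def)

lemma F_mono: "n \<le> m \<Longrightarrow> A \<in> sets (F n) \<Longrightarrow> A \<in> sets (F m)"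
  using F_minimal[of "F m" n] S_F' by fastforce

lemma S_F: "i \<le> n \<Longrightarrow> S i \<in> borel_measurable (F n)"
  using measurable_compose[OF S_F' borel_measurable_pos_borel[of "\<lambda>x. x"]] by simp

lemma drops_F: "i \<le> n \<Longrightarrow> (\<lambda>\<omega>. drops (\<lambda>n. S n \<omega>) i) \<in> F n \<rightarrow>\<^sub>M count_space UNIV"
proof (induction i)
  case (Suc i)
  have [measurable]: "(\<lambda>\<omega>. drops (\<lambda>n. S n \<omega>) i) \<in> F n \<rightarrow>\<^sub>M count_space UNIV"
    "S i \<in> borel_measurable (F n)" "S (Suc i) \<in> borel_measurable (F n)"
    using Suc by (auto intro: S_F)
  show ?case by (simp add: drops.simps(2))
qed simp

section \<open>One-step transitions of the chain\<close>

lemma transition_on: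
  assumes A: "A \<in> sets (F n)" and B: "B \<in> sets pos_borel"
  shows "emeasure M (A \<inter> (S (Suc n) -` B \<inter> space M)) = (\<integral>\<^sup>+\<omega>. indicator A \<omega> * emeasure (K (S n \<omega>)) B \<partial>M)"
proof -
  interpret finite_measure_subalgebra M "F n"
    by unfold_locales (rule F_subalgebra)
  note [measurable] = F_sets[OF A] B
  let ?f = "\<lambda>\<omega>. indicator B (S (Suc n) \<omega>) :: real"
  have int: "integrable M ?f"
    by (rule integrable_const_bound[of _ 1]) auto
  have [measurable]: "(\<lambda>\<omega>. measure (K (S n \<omega>)) B) \<in> borel_measurable M" by measurable
  have le1: "measure (K (S n \<omega>)) B \<le> 1" if "\<omega> \<in> space M" for \<omega>
    using prob_space.prob_le_1[OF K_prob[OF S_pos[OF that]]] .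
  have AE: "AE \<omega> in M. real_cond_exp M (F n) ?f \<omega> = measure (K (S n \<omega>)) B"
    using chain B by (simp add: markov_chain_def)
  have "measure M (A \<inter> (S (Suc n) -` B \<inter> space M)) = (\<integral>\<omega>. indicator (A \<inter> (S (Suc n) -` B \<inter> space M)) \<omega> \<partial>M)"
    by simp
  also have "\<dots> = (\<integral>\<omega>\<in>A. ?f \<omega> \<partial>M)"
    unfolding set_lebesgue_integral_def
    by (rule Bochner_Integration.integral_cong) (auto simp: indicator_def)
  \<comment> \<open>Integrating over an event of \<open>F n\<close> removes the conditional
    expectation, and the Markov property then identifies the integrand.\<close>
  also have "\<dots> = (\<integral>\<omega>\<in>A. real_cond_exp M (F n) ?f \<omega> \<partial>M)"
    by (rule real_cond_exp_intA[OF int A])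
  also have "\<dots> = (\<integral>\<omega>\<in>A. measure (K (S n \<omega>)) B \<partial>M)"
    unfolding set_lebesgue_integral_def
    by (rule integral_cong_AE) (use AE in auto)
  finally have "ennreal (measure M (A \<inter> (S (Suc n) -` B \<inter> space M))) = ennreal (\<integral>\<omega>\<in>A. measure (K (S n \<omega>)) B \<partial>M)"
    by simp
  also have "\<dots> = (\<integral>\<^sup>+\<omega>. ennreal (indicator A \<omega> * measure (K (S n \<omega>)) B) \<partial>M)"
    unfolding set_lebesgue_integral_def real_scaleR_def
    by (rule nn_integral_eq_integral[symmetric])
      (auto intro!: integrable_const_bound[of _ 1] AE_I2 simp: le1 indicator_def)
  also have "\<dots> = (\<integral>\<^sup>+\<omega>. indicator A \<omega> * emeasure (K (S n \<omega>)) B \<partial>M)"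
  proof (rule nn_integral_cong)
    fix \<omega> assume "\<omega> \<in> space M"
    then interpret K: prob_space "K (S n \<omega>)" by (intro K_prob S_pos)
    show "ennreal (indicator A \<omega> * measure (K (S n \<omega>)) B) = indicator A \<omega> * emeasure (K (S n \<omega>)) B"
      by (auto simp: K.emeasure_eq_measure indicator_def)
  qed
  finally show ?thesis by (simp add: emeasure_eq_measure)
qed

text \<open>Both sides integrate \<open>h\<close> against a measure on pairs: the law
  \<open>J1\<close> of two consecutive states on \<open>A\<close>, and \<open>J2\<close>, the law of
  the first state on \<open>A\<close> followed by a step of the kernel. They agree on rectangles,
  which form a generator stable under intersection.\<close>

lemma nn_integral_transition:
  assumes A: "A \<in> sets (F n)" and h [measurable]: "h \<in> borel_measurable (pos_borel \<Otimes>\<^sub>M pos_borel)"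
  shows "(\<integral>\<^sup>+\<omega>. indicator A \<omega> * h (S n \<omega>, S (Suc n) \<omega>) \<partial>M) =
    (\<integral>\<^sup>+\<omega>. indicator A \<omega> * (\<integral>\<^sup>+y. h (S n \<omega>, y) \<partial>K (S n \<omega>)) \<partial>M)"
proof -
  note [measurable] = F_sets[OF A]
  let ?N = pos_borel
  let ?P = "pos_borel \<Otimes>\<^sub>M pos_borel :: (real \<times> real) measure"
  \<comment> \<open>\<open>M'\<close> is \<open>M\<close> restricted to \<open>A\<close>, and
    \<open>L s\<close> is the law of the pair \<open>(s, y)\<close> with \<open>y\<close> drawn from
    \<open>K s\<close>.\<close>
  define M' where "M' = density M (indicator A)"
  define L where "L = (\<lambda>s. K s \<bind> (\<lambda>y. return ?P (s, y)))"
  have [measurable_cong]: "sets M' = sets M" by (simp add: M'_def)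
  have L [measurable]: "L \<in> ?N \<rightarrow>\<^sub>M subprob_algebra ?P" unfolding L_def by measurable
  define J1 where "J1 = distr M' ?P (\<lambda>\<omega>. (S n \<omega>, S (Suc n) \<omega>))"
  define J2 where "J2 = distr M' ?N (S n) \<bind> L"
  have nn_L: "(\<integral>\<^sup>+z. g z \<partial>L s) = (\<integral>\<^sup>+y. g (s, y) \<partial>K s)"
    if g [measurable]: "g \<in> borel_measurable ?P" and s: "s > 0" for g s
  proof -
    have s' [measurable]: "s \<in> space ?N" using s by (simp add: space_pos_borel)
    have "(\<lambda>y. return ?P (s, y)) \<in> ?N \<rightarrow>\<^sub>M subprob_algebra ?P" by measurable
    then have ret: "(\<lambda>y. return ?P (s, y)) \<in> K s \<rightarrow>\<^sub>M subprob_algebra ?P"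
      by (simp add: measurable_cong_sets[OF sets_K[OF s] refl])
    have "(\<integral>\<^sup>+z. g z \<partial>L s) = (\<integral>\<^sup>+y. \<integral>\<^sup>+z. g z \<partial>return ?P (s, y) \<partial>K s)"
      unfolding L_def by (rule nn_integral_bind[OF g ret])
    also have "\<dots> = (\<integral>\<^sup>+y. g (s, y) \<partial>K s)"
    proof (rule nn_integral_cong)
      fix y assume "y \<in> space (K s)"
      then have "(s, y) \<in> space ?P"
        using s' sets_eq_imp_space_eq[OF sets_K[OF s]] by (simp add: space_pair_measure)
      then show "(\<integral>\<^sup>+z. g z \<partial>return ?P (s, y)) = g (s, y)"
        using g by (rule nn_integral_return)
    qed
    finally show ?thesis .
  qed
  \<comment> \<open>\<open>bind\<close> is degenerate over an empty space, so
    \<open>sets_bind\<close> asks for this.\<close>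
  have ne: "space (distr M' ?N (S n)) \<noteq> {}" by (simp add: space_pos_borel)
  have nn_J2: "(\<integral>\<^sup>+z. g z \<partial>J2) = (\<integral>\<^sup>+\<omega>. indicator A \<omega> * (\<integral>\<^sup>+y. g (S n \<omega>, y) \<partial>K (S n \<omega>)) \<partial>M)"
    if g [measurable]: "g \<in> borel_measurable ?P" for g
  proof -
    have "(\<integral>\<^sup>+z. g z \<partial>J2) = (\<integral>\<^sup>+s. \<integral>\<^sup>+z. g z \<partial>L s \<partial>distr M' ?N (S n))"
      unfolding J2_def by (rule nn_integral_bind[where B = ?P]) measurable
    also have "\<dots> = (\<integral>\<^sup>+\<omega>. \<integral>\<^sup>+z. g z \<partial>L (S n \<omega>) \<partial>M')"
      by (rule nn_integral_distr) measurable
    also have "\<dots> = (\<integral>\<^sup>+\<omega>. indicator A \<omega> * (\<integral>\<^sup>+z. g z \<partial>L (S n \<omega>)) \<partial>M)"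
      unfolding M'_def by (rule nn_integral_density) measurable
    also have "\<dots> = (\<integral>\<^sup>+\<omega>. indicator A \<omega> * (\<integral>\<^sup>+y. g (S n \<omega>, y) \<partial>K (S n \<omega>)) \<partial>M)"
      by (rule nn_integral_cong) (simp add: nn_L S_pos)
    finally show ?thesis .
  qed
  have nn_J1: "(\<integral>\<^sup>+z. g z \<partial>J1) = (\<integral>\<^sup>+\<omega>. indicator A \<omega> * g (S n \<omega>, S (Suc n) \<omega>) \<partial>M)"
    if g [measurable]: "g \<in> borel_measurable ?P" for g
  proof -
    have "(\<integral>\<^sup>+z. g z \<partial>J1) = (\<integral>\<^sup>+\<omega>. g (S n \<omega>, S (Suc n) \<omega>) \<partial>M')"
      unfolding J1_def by (rule nn_integral_distr) measurable
    also have "\<dots> = (\<integral>\<^sup>+\<omega>. indicator A \<omega> * g (S n \<omega>, S (Suc n) \<omega>) \<partial>M)"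
      unfolding M'_def by (rule nn_integral_density) measurable
    finally show ?thesis .
  qed
  have sets_J1: "sets J1 = sets ?P" by (simp add: J1_def)
  have sets_J2: "sets J2 = sets ?P"
    unfolding J2_def by (rule sets_bind[OF _ ne]) (simp add: sets_kernel[OF L])
  let ?E = "{a \<times> b | a b. a \<in> sets ?N \<and> b \<in> sets ?N}"
  let ?\<Omega> = "space ?N \<times> space ?N"
  have "J1 = J2"
  proof (rule measure_eqI_generator_eq[where E = ?E and \<Omega> = ?\<Omega> and A = "\<lambda>_. ?\<Omega>"])
    show "Int_stable ?E" by (rule Int_stable_pair_measure_generator)
    show "?E \<subseteq> Pow ?\<Omega>" using sets.sets_into_space by fastforce
    show "sets J1 = sigma_sets ?\<Omega> ?E" "sets J2 = sigma_sets ?\<Omega> ?E"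
      by (simp_all add: sets_J1 sets_J2 sets_pair_measure)
    show "range (\<lambda>_::nat. ?\<Omega>) \<subseteq> ?E" by auto
    show "(\<Union>i::nat. ?\<Omega>) = ?\<Omega>" by simp
    have "emeasure J1 ?\<Omega> = (\<integral>\<^sup>+z. indicator ?\<Omega> z \<partial>J1)"
      by (simp add: sets_J1)
    also have "\<dots> \<le> (\<integral>\<^sup>+\<omega>. 1 \<partial>M)"
      by (subst nn_J1, measurable, rule nn_integral_mono) (auto simp: indicator_def)
    finally show "emeasure J1 ?\<Omega> \<noteq> \<infinity>" by (auto simp: emeasure_space_1 top_unique)
  next
    fix X assume "X \<in> ?E"
    then obtain a b where X: "X = a \<times> b" and [measurable]: "a \<in> sets ?N" "b \<in> sets ?N" by blast
    \<comment> \<open>The condition on the present state is absorbed into the event of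
      \<open>F n\<close>, which leaves only a condition on the next state, as in
      \<open>transition_on\<close>.\<close>
    have A': "A \<inter> (S n -` a \<inter> space M) \<in> sets (F n)"
      using A measurable_sets[OF S_F'[OF order_refl] \<open>a \<in> sets ?N\<close>] by auto
    have X' [measurable]: "X \<in> sets ?P" by (simp add: X)
    have "emeasure J1 X = (\<integral>\<^sup>+z. indicator X z \<partial>J1)" by (simp add: sets_J1 X)
    also have "\<dots> = (\<integral>\<^sup>+\<omega>. indicator ((A \<inter> (S n -` a \<inter> space M)) \<inter> (S (Suc n) -` b \<inter> space M)) \<omega> \<partial>M)"
      unfolding nn_J1[OF borel_measurable_indicator[OF X']]
      by (rule nn_integral_cong) (simp add: X indicator_def)
    also have "\<dots> = emeasure M ((A \<inter> (S n -` a \<inter> space M)) \<inter> (S (Suc n) -` b \<inter> space M))"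
      by (rule nn_integral_indicator) measurable
    also have "\<dots> = (\<integral>\<^sup>+\<omega>. indicator (A \<inter> (S n -` a \<inter> space M)) \<omega> * emeasure (K (S n \<omega>)) b \<partial>M)"
      by (rule transition_on[OF A' \<open>b \<in> sets ?N\<close>])
    also have "\<dots> = (\<integral>\<^sup>+\<omega>. indicator A \<omega> * (\<integral>\<^sup>+y. indicator X (S n \<omega>, y) \<partial>K (S n \<omega>)) \<partial>M)"
    proof (rule nn_integral_cong)
      fix \<omega> assume \<omega>: "\<omega> \<in> space M"
      have "(\<integral>\<^sup>+y. indicator X (S n \<omega>, y) \<partial>K (S n \<omega>)) = (\<integral>\<^sup>+y. indicator a (S n \<omega>) * indicator b y \<partial>K (S n \<omega>))"
        unfolding X by (rule nn_integral_cong) (auto simp: indicator_def)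
      also have "\<dots> = indicator a (S n \<omega>) * emeasure (K (S n \<omega>)) b"
        by (rule nn_integral_cmult_indicator) (simp add: sets_K[OF S_pos[OF \<omega>]])
      finally show "indicator (A \<inter> (S n -` a \<inter> space M)) \<omega> * emeasure (K (S n \<omega>)) b =
          indicator A \<omega> * (\<integral>\<^sup>+y. indicator X (S n \<omega>, y) \<partial>K (S n \<omega>))"
        using \<omega> by (auto simp: indicator_def)
    qed
    also have "\<dots> = (\<integral>\<^sup>+z. indicator X z \<partial>J2)"
      by (rule nn_J2[OF borel_measurable_indicator[OF X'], symmetric])
    also have "\<dots> = emeasure J2 X" by (simp add: sets_J2 X)
    finally show "emeasure J1 X = emeasure J2 X" .
  qed
  then show ?thesis using nn_J1[OF h] nn_J2[OF h] by simp
qed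

section \<open>First moments of the kernel\<close>

lemma id_pos_borel: "(\<lambda>x. x) \<in> borel_measurable pos_borel"
  by (rule borel_measurable_pos_borel) simp

lemma borel_measurable_K: "s > 0 \<Longrightarrow> f \<in> borel_measurable borel \<Longrightarrow> f \<in> borel_measurable (K s)"
  using borel_measurable_pos_borel by (simp add: measurable_cong_sets[OF sets_K refl])

lemma space_K: "s > 0 \<Longrightarrow> space (K s) = {0<..}"
  using sets_eq_imp_space_eq[OF sets_K] space_pos_borel by simp

lemma integrable_K: "s > 0 \<Longrightarrow> integrable (K s) (\<lambda>y. y)"
  and integral_K: "s > 0 \<Longrightarrow> (\<integral>y. y \<partial>K s) = s"
  using kernel by (auto simp: martingale_kernel_def)

lemma nn_integral_K: "s > 0 \<Longrightarrow> (\<integral>\<^sup>+y. ennreal y \<partial>K s) = ennreal s"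
  by (subst nn_integral_eq_integral[OF integrable_K])
    (auto intro!: AE_I2 simp: space_K integral_K)

text \<open>The mean of \<open>K s\<close> is \<open>s\<close>, and the part below \<open>s\<close>
  contributes \<open>s * drop_mean K s\<close>; this is what remains.\<close>

lemma nn_integral_K_atLeast:
  assumes s: "s > 0"
  shows "(\<integral>\<^sup>+y. ennreal y * indicator {s..} y \<partial>K s) = ennreal (s * (1 - drop_mean K s))"
proof -
  \<comment> \<open>This is the integrand of \<open>drop_mean\<close>. The subtraction is carried
    out with Bochner integrals, hence the integrability facts.\<close>
  define g where "g y = indicator {0<..<s} y *\<^sub>R (y / s)" for y
  have "g \<in> borel_measurable borel" unfolding g_def by measurable
  then have meas: "g \<in> borel_measurable (K s)" by (rule borel_measurable_K[OF s])
  have bound: "0 \<le> g y" "s * g y = (if y < s then y else 0)" if "y > 0" for y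
    using that s by (auto simp: g_def)
  have int: "integrable (K s) g"
    by (rule Bochner_Integration.integrable_bound[OF integrable_divide[OF integrable_K[OF s], of s] meas])
      (use s in \<open>auto simp: g_def indicator_def\<close>)
  have int': "integrable (K s) (\<lambda>y. y - s * g y)"
    by (intro Bochner_Integration.integrable_diff integrable_K[OF s] integrable_mult_right int)
  have "(\<integral>\<^sup>+y. ennreal y * indicator {s..} y \<partial>K s) = (\<integral>\<^sup>+y. ennreal (y - s * g y) \<partial>K s)"
    by (rule nn_integral_cong) (simp add: space_K[OF s] bound indicator_def)
  also have "\<dots> = ennreal (\<integral>y. y - s * g y \<partial>K s)"
    by (rule nn_integral_eq_integral[OF int' AE_I2]) (simp add: space_K[OF s] bound)
  also have "(\<integral>y. y - s * g y \<partial>K s) = s - s * (\<integral>y. g y \<partial>K s)"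
    by (subst Bochner_Integration.integral_diff[OF integrable_K[OF s] integrable_mult_right[OF int]])
      (simp only: integral_K[OF s] integral_mult_right_zero)
  also have "(\<integral>y. g y \<partial>K s) = drop_mean K s"
    by (simp only: g_def drop_mean_def set_lebesgue_integral_def)
  finally show ?thesis by (simp only: right_diff_distrib mult_1_right)
qed

section \<open>Change of measure with density \<open>S n\<close>\<close>

abbreviation Q :: "nat \<Rightarrow> 'w measure" where
  "Q n \<equiv> density M (\<lambda>\<omega>. ennreal (S n \<omega>))"

lemma emeasure_Q: "A \<in> sets M \<Longrightarrow> emeasure (Q n) A = (\<integral>\<^sup>+\<omega>. indicator A \<omega> * ennreal (S n \<omega>) \<partial>M)"
  by (subst emeasure_density) (auto simp: mult.commute)

text \<open>The martingale property as consistency of the measures: given the present state, the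
  next one has mean \<open>S n\<close>.\<close>

lemma Q_Suc:
  assumes "A \<in> sets (F n)"
  shows "emeasure (Q (Suc n)) A = emeasure (Q n) A"
proof -
  have meas: "(\<lambda>p. ennreal (snd p)) \<in> borel_measurable (pos_borel \<Otimes>\<^sub>M pos_borel)"
    by (intro measurable_compose[OF _ measurable_ennreal] measurable_compose[OF measurable_snd id_pos_borel])
  have "(\<integral>\<^sup>+\<omega>. indicator A \<omega> * ennreal (S (Suc n) \<omega>) \<partial>M) =
      (\<integral>\<^sup>+\<omega>. indicator A \<omega> * (\<integral>\<^sup>+y. ennreal y \<partial>K (S n \<omega>)) \<partial>M)"
    using nn_integral_transition[OF assms meas] by simp
  also have "\<dots> = (\<integral>\<^sup>+\<omega>. indicator A \<omega> * ennreal (S n \<omega>) \<partial>M)"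
    by (rule nn_integral_cong) (simp add: nn_integral_K S_pos)
  finally show ?thesis by (simp add: emeasure_Q F_sets[OF assms])
qed

lemma Q_eq: "n \<le> m \<Longrightarrow> A \<in> sets (F n) \<Longrightarrow> emeasure (Q m) A = emeasure (Q n) A"
  by (induction m rule: dec_induct) (simp_all add: Q_Suc F_mono)

lemma nn_integral_S_0: "(\<integral>\<^sup>+\<omega>. ennreal (S 0 \<omega>) \<partial>M) = ennreal x"
proof -
  have "(\<integral>\<^sup>+\<omega>. ennreal (S 0 \<omega>) \<partial>M) = (\<integral>\<^sup>+\<omega>. ennreal x \<partial>M)"
    using chain by (intro nn_integral_cong_AE) (auto simp: markov_chain_def)
  then show ?thesis by (simp add: emeasure_space_1)
qed

text \<open>Consistency carries the total mass back to time 0. The measures are thus finite, with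
  mass \<open>x\<close> rather than 1.\<close>

lemma Q_space: "emeasure (Q n) (space M) = ennreal x"
proof -
  have "emeasure (Q n) (space M) = emeasure (Q 0) (space M)"
    using sets.top[of "F 0"] by (intro Q_eq) auto
  also have "\<dots> = (\<integral>\<^sup>+\<omega>. ennreal (S 0 \<omega>) \<partial>M)"
    by (subst emeasure_density) (auto intro!: nn_integral_cong)
  finally show ?thesis by (simp add: nn_integral_S_0)
qed

lemma Q_le: "emeasure (Q n) A \<le> ennreal x"
  using emeasure_space[of "Q n" A] by (simp add: Q_space)

text \<open>From a state \<open>s\<close>, the share of the mass that moves to \<open>s\<close> or
  higher is \<open>1 - drop_mean K s\<close>, hence at most \<open>1 - \<epsilon>\<close> above
  level \<open>a\<close>.\<close>

lemma Q_upward_contraction: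
  assumes A: "A \<in> sets (F n)" and above: "\<And>\<omega>. \<omega> \<in> A \<Longrightarrow> a < S n \<omega>"
    and drop: "\<And>s. s > a \<Longrightarrow> \<epsilon> \<le> drop_mean K s" and "\<epsilon> < 1"
  shows "emeasure (Q (Suc n)) (A \<inter> {\<omega> \<in> space M. S n \<omega> \<le> S (Suc n) \<omega>}) \<le> ennreal (1 - \<epsilon>) * emeasure (Q n) A"
proof -
  have [measurable]: "A \<in> sets M" using F_sets[OF A] .
  have meas: "(\<lambda>p. ennreal (snd p) * indicator {p. fst p \<le> snd p} p) \<in> borel_measurable (pos_borel \<Otimes>\<^sub>M pos_borel)"
  proof -
    have [measurable]: "(\<lambda>p. fst p) \<in> borel_measurable (pos_borel \<Otimes>\<^sub>M pos_borel)"
      "(\<lambda>p. snd p) \<in> borel_measurable (pos_borel \<Otimes>\<^sub>M pos_borel)"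
      by (rule measurable_compose[OF measurable_fst id_pos_borel]
          measurable_compose[OF measurable_snd id_pos_borel])+
    show ?thesis by measurable
  qed
  have "emeasure (Q (Suc n)) (A \<inter> {\<omega> \<in> space M. S n \<omega> \<le> S (Suc n) \<omega>}) =
      (\<integral>\<^sup>+\<omega>. indicator A \<omega> * (ennreal (S (Suc n) \<omega>) * indicator {p. fst p \<le> snd p} (S n \<omega>, S (Suc n) \<omega>)) \<partial>M)"
    by (subst emeasure_Q, measurable) (auto intro!: nn_integral_cong simp: indicator_def)
  also have "\<dots> = (\<integral>\<^sup>+\<omega>. indicator A \<omega> * (\<integral>\<^sup>+y. ennreal y * indicator {p. fst p \<le> snd p} (S n \<omega>, y) \<partial>K (S n \<omega>)) \<partial>M)"
    using nn_integral_transition[OF A meas] by simp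
  also have "\<dots> \<le> (\<integral>\<^sup>+\<omega>. ennreal (1 - \<epsilon>) * (indicator A \<omega> * ennreal (S n \<omega>)) \<partial>M)"
  proof (rule nn_integral_mono)
    fix \<omega> assume "\<omega> \<in> space M"
    then have pos: "S n \<omega> > 0" by (rule S_pos)
    show "indicator A \<omega> * (\<integral>\<^sup>+y. ennreal y * indicator {p. fst p \<le> snd p} (S n \<omega>, y) \<partial>K (S n \<omega>))
        \<le> ennreal (1 - \<epsilon>) * (indicator A \<omega> * ennreal (S n \<omega>))"
    proof (cases "\<omega> \<in> A")
      case True
      have "(\<integral>\<^sup>+y. ennreal y * indicator {p. fst p \<le> snd p} (S n \<omega>, y) \<partial>K (S n \<omega>)) =
          (\<integral>\<^sup>+y. ennreal y * indicator {S n \<omega>..} y \<partial>K (S n \<omega>))"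
        by (rule nn_integral_cong) (simp add: indicator_def)
      also have "\<dots> = ennreal (S n \<omega> * (1 - drop_mean K (S n \<omega>)))"
        by (rule nn_integral_K_atLeast[OF pos])
      also have "\<dots> \<le> ennreal ((1 - \<epsilon>) * S n \<omega>)"
        using drop[OF above[OF True]] pos by (intro ennreal_leI) (simp add: mult.commute)
      also have "\<dots> = ennreal (1 - \<epsilon>) * ennreal (S n \<omega>)"
        using \<open>\<epsilon> < 1\<close> by (intro ennreal_mult') simp
      finally show ?thesis using True by simp
    qed simp
  qed
  also have "\<dots> = ennreal (1 - \<epsilon>) * emeasure (Q n) A"
    by (subst nn_integral_cmult) (simp_all add: emeasure_Q)
  finally show ?thesis .
qed

text \<open>By consistency the single measure \<open>Q N\<close> can measure the first
  \<open>N\<close> events, and there disjointness bounds the sum by the total mass.\<close>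

lemma Q_disjoint_sum_le:
  assumes A: "\<And>i. A i \<in> sets (F (Suc i))" and disj: "disjoint_family A"
  shows "(\<Sum>i. emeasure (Q (Suc i)) (A i)) \<le> ennreal x"
proof (rule suminf_le_const)
  fix N
  have "(\<Sum>i<N. emeasure (Q (Suc i)) (A i)) = (\<Sum>i<N. emeasure (Q N) (A i))"
    using A by (intro sum.cong refl Q_eq[symmetric]) auto
  also have "\<dots> = emeasure (Q N) (\<Union>i<N. A i)"
    using F_sets[OF A] disjoint_family_on_mono[OF subset_UNIV disj]
    by (intro sum_emeasure) auto
  also have "\<dots> \<le> ennreal x" by (rule Q_le)
  finally show "(\<Sum>i<N. emeasure (Q (Suc i)) (A i)) \<le> ennreal x" .
qed simp

section \<open>Mass above a high level\<close>

abbreviation D :: "nat \<Rightarrow> 'w \<Rightarrow> nat" where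
  "D n \<omega> \<equiv> drops (\<lambda>i. S i \<omega>) n"

lemma mono_D: "n \<le> m \<Longrightarrow> D n \<omega> \<le> D m \<omega>"
  by (rule monoD[OF mono_drops])

text \<open>A common schema for the events below: \<open>P\<close> constrains the counts and
  \<open>R\<close> the positions relative to \<open>a\<close> at two times.\<close>

lemma path_event_F:
  assumes "i \<le> n" "j \<le> n"
  shows "{\<omega> \<in> space M. P (D i \<omega>) (D j \<omega>) \<and> R (S i \<omega> \<le> a) (S j \<omega> \<le> a)} \<in> sets (F n)"
proof -
  note [measurable] = S_F[OF assms(1)] S_F[OF assms(2)] drops_F[OF assms(1)] drops_F[OF assms(2)]
  have "{\<omega> \<in> space (F n). P (D i \<omega>) (D j \<omega>) \<and> R (S i \<omega> \<le> a) (S j \<omega> \<le> a)} \<in> sets (F n)"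
    by measurable
  then show ?thesis by simp
qed

text \<open>The mass above \<open>a\<close> with exactly \<open>j\<close> drops contracts, up to the mass that crosses \<open>a\<close>
  upwards without a drop and the mass inherited from \<open>j - 1\<close> drops. A path crosses \<open>a\<close> at most once
  while it has \<open>j\<close> drops, so the crossings are disjoint events and contribute at most \<open>x\<close>.\<close>

lemma summable_mass_above:
  assumes drop: "\<And>s. s > a \<Longrightarrow> \<epsilon> \<le> drop_mean K s" and \<epsilon>: "0 < \<epsilon>" "\<epsilon> < 1"
  shows "(\<Sum>n. emeasure (Q n) {\<omega> \<in> space M. D n \<omega> = j \<and> a < S n \<omega>}) < \<infinity>"
proof (induction j rule: less_induct)
  case (less j)
  define V where "V n = {\<omega> \<in> space M. D n \<omega> = j \<and> a < S n \<omega>}" for n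
  define U where "U n = {\<omega> \<in> space M. D n \<omega> = j \<and> D (Suc n) \<omega> = j \<and> S n \<omega> \<le> a \<and> a < S (Suc n) \<omega>}" for n
  define W where "W n = {\<omega> \<in> space M. Suc (D n \<omega>) = j \<and> a < S n \<omega>}" for n
  have V: "V n \<in> sets (F n)" for n
    using path_event_F[of n n n "\<lambda>d _. d = j" "\<lambda>b _. \<not> b"] by (simp add: V_def not_le)
  have W: "W n \<in> sets (F n)" for n
    using path_event_F[of n n n "\<lambda>d _. Suc d = j" "\<lambda>b _. \<not> b"] by (simp add: W_def not_le)
  have U: "U n \<in> sets (F (Suc n))" for n
    using path_event_F[of n "Suc n" "Suc n" "\<lambda>d e. d = j \<and> e = j" "\<lambda>b c. b \<and> \<not> c"]
    by (simp add: U_def not_le)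
  have "U n \<inter> U m = {}" if "n < m" for n m
  proof -
    \<comment> \<open>After the crossing at \<open>n\<close> the count stays \<open>j\<close> up to
      \<open>m\<close>, so the path cannot fall from above \<open>a\<close> at \<open>Suc n\<close>
      to at most \<open>a\<close> at \<open>m\<close>.\<close>
    have False if "\<omega> \<in> U n" "\<omega> \<in> U m" for \<omega>
      using drops_eq_imp_le[of "Suc n" m "\<lambda>i. S i \<omega>"] that \<open>n < m\<close> by (auto simp: U_def)
    then show ?thesis by blast
  qed
  then have "disjoint_family U"
    unfolding disjoint_family_on_def by (metis Int_commute nat_neq_iff)
  then have sum_U: "(\<Sum>n. emeasure (Q (Suc n)) (U n)) \<le> ennreal x"
    by (rule Q_disjoint_sum_le[OF U])
  \<comment> \<open>The inflow from \<open>j - 1\<close> drops is the mass treated by the induction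
    hypothesis; for \<open>j = 0\<close> it is empty.\<close>
  have sum_W: "(\<Sum>n. emeasure (Q n) (W n)) < \<infinity>"
  proof (cases j)
    case 0
    then show ?thesis by (simp add: W_def)
  next
    case (Suc i)
    then show ?thesis using less.IH[of i] by (simp add: W_def)
  qed
  have "(\<Sum>n. emeasure (Q n) (V n)) < \<infinity>"
  proof (rule suminf_finite_of_contraction)
    show "emeasure (Q n) (V n) < \<infinity>" for n
      using le_less_trans[OF Q_le ennreal_less_top] by simp
    show "0 \<le> 1 - \<epsilon>" "1 - \<epsilon> < 1" using \<epsilon> by auto
    have "(\<Sum>n. emeasure (Q (Suc n)) (U n) + emeasure (Q n) (W n)) =
        (\<Sum>n. emeasure (Q (Suc n)) (U n)) + (\<Sum>n. emeasure (Q n) (W n))"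
      by (simp add: suminf_add)
    also have "\<dots> < \<infinity>" using le_less_trans[OF sum_U ennreal_less_top] sum_W by simp
    finally show "(\<Sum>n. emeasure (Q (Suc n)) (U n) + emeasure (Q n) (W n)) < \<infinity>" .
  next
    fix n
    let ?up = "V n \<inter> {\<omega> \<in> space M. S n \<omega> \<le> S (Suc n) \<omega>}"
    have [measurable]: "V n \<in> sets M" "W n \<in> sets M" "U n \<in> sets M"
      using F_sets V W U by auto
    \<comment> \<open>If the last step is a drop that ends above \<open>a\<close>, it also started
      above \<open>a\<close>, which gives \<open>W n\<close>. Otherwise the count was already
      \<open>j\<close>, and the starting point lies above \<open>a\<close> (\<open>?up\<close>) or
      not (\<open>U n\<close>).\<close>
    have "V (Suc n) \<subseteq> ?up \<union> (U n \<union> W n)"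
      by (auto simp: V_def U_def W_def drops.simps(2) split: if_splits)
    then have "emeasure (Q (Suc n)) (V (Suc n)) \<le> emeasure (Q (Suc n)) (?up \<union> (U n \<union> W n))"
      by (rule emeasure_mono) simp
    also have "\<dots> \<le> emeasure (Q (Suc n)) ?up + emeasure (Q (Suc n)) (U n \<union> W n)"
      by (rule emeasure_subadditive) simp_all
    also have "\<dots> \<le> emeasure (Q (Suc n)) ?up + (emeasure (Q (Suc n)) (U n) + emeasure (Q (Suc n)) (W n))"
      by (intro add_left_mono emeasure_subadditive) simp_all
    also have "emeasure (Q (Suc n)) ?up \<le> ennreal (1 - \<epsilon>) * emeasure (Q n) (V n)"
      by (rule Q_upward_contraction[OF V _ drop \<epsilon>(2)]) (simp_all add: V_def)
    finally show "emeasure (Q (Suc n)) (V (Suc n)) \<le> ennreal (1 - \<epsilon>) * emeasure (Q n) (V n) +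
        (emeasure (Q (Suc n)) (U n) + emeasure (Q n) (W n))"
      by (simp add: Q_Suc[OF W] add_right_mono)
  qed
  then show ?case by (simp add: V_def)
qed

text \<open>Fewer than \<open>k\<close> drops leave finitely many counts, and for each of them the
  masses are summable, hence tend to 0.\<close>

lemma mass_above_tendsto_0:
  assumes drop: "\<And>s. s > a \<Longrightarrow> \<epsilon> \<le> drop_mean K s" and \<epsilon>: "0 < \<epsilon>" "\<epsilon> < 1"
  shows "(\<lambda>n. emeasure (Q n) {\<omega> \<in> space M. D n \<omega> < k \<and> a < S n \<omega>}) \<longlonglongrightarrow> 0"
proof -
  define V where "V j n = {\<omega> \<in> space M. D n \<omega> = j \<and> a < S n \<omega>}" for j n
  have V: "V j n \<in> sets M" for j n
    using F_sets[OF path_event_F[of n n n "\<lambda>d _. d = j" "\<lambda>b _. \<not> b"]] by (simp add: V_def not_le)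
  have lim: "(\<lambda>n. emeasure (Q n) (V j n)) \<longlonglongrightarrow> 0" for j
  proof -
    \<comment> \<open>The passage through reals makes the convergence to 0 of summable terms
      available.\<close>
    have fin: "emeasure (Q n) (V j n) = ennreal (enn2real (emeasure (Q n) (V j n)))" for n
      using le_less_trans[OF Q_le ennreal_less_top] by (simp add: ennreal_enn2real)
    have "(\<Sum>n. ennreal (enn2real (emeasure (Q n) (V j n)))) \<noteq> top"
      using summable_mass_above[where j = j and a = a, OF drop \<epsilon>] by (simp add: fin[symmetric] V_def[symmetric])
    then have "summable (\<lambda>n. enn2real (emeasure (Q n) (V j n)))"
      by (intro summable_suminf_not_top) auto
    from tendsto_ennrealI[OF summable_LIMSEQ_zero[OF this]] show ?thesis
      by (simp add: fin[symmetric])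
  qed
  have "emeasure (Q n) {\<omega> \<in> space M. D n \<omega> < k \<and> a < S n \<omega>} = (\<Sum>j<k. emeasure (Q n) (V j n))" for n
  proof -
    have "{\<omega> \<in> space M. D n \<omega> < k \<and> a < S n \<omega>} = (\<Union>j<k. V j n)" by (auto simp: V_def)
    then show ?thesis
      using V by (subst sum_emeasure) (auto simp: disjoint_family_on_def V_def)
  qed
  moreover have "(\<lambda>n. \<Sum>j<k. emeasure (Q n) (V j n)) \<longlonglongrightarrow> (\<Sum>j<k. 0)"
    by (intro tendsto_sum lim)
  ultimately show ?thesis by simp
qed

section \<open>Optional stopping and the passage to the limit\<close>

lemma optional_stopping:
  assumes "k \<ge> 1"
  shows "ennreal x = (\<Sum>i<n. emeasure (Q (Suc i)) {\<omega> \<in> space M. D i \<omega> < k \<and> k \<le> D (Suc i) \<omega>})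
    + emeasure (Q n) {\<omega> \<in> space M. D n \<omega> < k}"
\<comment> \<open>The right side is the expectation of the path stopped at the minimum of
  \<open>n\<close> and the \<open>k\<close>-th drop time, split by whether the drop has occurred. At
  \<open>n = 0\<close> nothing is stopped, as \<open>k\<close> is positive.\<close>
proof (induction n)
  case 0
  then show ?case using assms by (simp add: Q_space)
next
  case (Suc n)
  have less: "{\<omega> \<in> space M. D m \<omega> < k} \<in> sets (F m)" for m
    using path_event_F[of m m m "\<lambda>d _. d < k" "\<lambda>_ _. True"] by simp
  have stop: "{\<omega> \<in> space M. D n \<omega> < k \<and> k \<le> D (Suc n) \<omega>} \<in> sets (F (Suc n))"
    using path_event_F[of n "Suc n" "Suc n" "\<lambda>d e. d < k \<and> k \<le> e" "\<lambda>_ _. True"] by simp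
  \<comment> \<open>The mass not yet stopped at \<open>n\<close> either stops at
    \<open>Suc n\<close> or carries on; monotonicity of the count makes this a partition.\<close>
  have split: "{\<omega> \<in> space M. D n \<omega> < k} =
      {\<omega> \<in> space M. D n \<omega> < k \<and> k \<le> D (Suc n) \<omega>} \<union> {\<omega> \<in> space M. D (Suc n) \<omega> < k}"
    using mono_D[of n "Suc n"] le_less_trans by (auto simp: not_le)
  have "emeasure (Q n) {\<omega> \<in> space M. D n \<omega> < k} = emeasure (Q (Suc n)) {\<omega> \<in> space M. D n \<omega> < k}"
    by (rule Q_Suc[OF less, symmetric])
  also have "\<dots> = emeasure (Q (Suc n)) {\<omega> \<in> space M. D n \<omega> < k \<and> k \<le> D (Suc n) \<omega>}
      + emeasure (Q (Suc n)) {\<omega> \<in> space M. D (Suc n) \<omega> < k}"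
    using F_sets[OF less] F_sets[OF stop] by (subst split) (intro plus_emeasure[symmetric], auto)
  finally show ?case using Suc.IH by (simp add: add.assoc)
qed

text \<open>As \<open>n\<close> grows in the optional stopping identity, the stopped part tends to a
  series, the mass in \<open>B n\<close> to the integral of \<open>l\<close>, and the mass in
  \<open>V n\<close> to 0. The pathwise bound then gives at least \<open>x\<close> for every
  \<open>k\<close>.\<close>

lemma not_bubble:
  assumes drop: "\<And>s. s > a \<Longrightarrow> \<epsilon> \<le> drop_mean K s" and \<epsilon>: "0 < \<epsilon>" "\<epsilon> < 1"
  shows "\<not> bubble M S"
proof -
  have "ennreal x \<le> (\<integral>\<^sup>+\<omega>. ennreal (value_at (\<lambda>n. S n \<omega>) (drop_time (\<lambda>n. S n \<omega>) k)) \<partial>M)"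
    if k: "k \<ge> 1" for k
  proof -
    define G where "G i = {\<omega> \<in> space M. D i \<omega> < k \<and> k \<le> D (Suc i) \<omega>}" for i
    define B where "B n = {\<omega> \<in> space M. D n \<omega> < k \<and> S n \<omega> \<le> a}" for n
    define V where "V n = {\<omega> \<in> space M. D n \<omega> < k \<and> a < S n \<omega>}" for n
    have [measurable]: "G i \<in> sets M" for i
      using F_sets[OF path_event_F[of i "Suc i" "Suc i" "\<lambda>d e. d < k \<and> k \<le> e" "\<lambda>_ _. True"]]
      by (simp add: G_def)
    have [measurable]: "B n \<in> sets M" for n
      using F_sets[OF path_event_F[of n n n "\<lambda>d _. d < k" "\<lambda>b _. b"]] by (simp add: B_def)
    have [measurable]: "V n \<in> sets M" for n
      using F_sets[OF path_event_F[of n n n "\<lambda>d _. d < k" "\<lambda>b _. \<not> b"]] by (simp add: V_def not_le)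
    define f where "f n \<omega> = indicator (B n) \<omega> * ennreal (S n \<omega>)" for n \<omega>
    define g where "g i \<omega> = indicator (G i) \<omega> * ennreal (S (Suc i) \<omega>)" for i \<omega>
    \<comment> \<open>The limsup selects the pathwise limit measurably in
      \<open>\<omega>\<close>.\<close>
    define l where "l \<omega> = limsup (\<lambda>n. f n \<omega>)" for \<omega>
    have [measurable]: "f n \<in> borel_measurable M" "g n \<in> borel_measurable M" for n
      unfolding f_def g_def by measurable
    have [measurable]: "l \<in> borel_measurable M" unfolding l_def by measurable
    have path: "(\<lambda>n. f n \<omega>) \<longlonglongrightarrow> l \<omega> \<and>
        (\<Sum>i. g i \<omega>) + l \<omega> \<le> ennreal (value_at (\<lambda>n. S n \<omega>) (drop_time (\<lambda>n. S n \<omega>) k))"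
      if \<omega>: "\<omega> \<in> space M" for \<omega>
    proof -
      have f: "f n \<omega> = ennreal (S n \<omega>) * indicator {n. D n \<omega> < k \<and> S n \<omega> \<le> a} n" for n
        using \<omega> by (auto simp: f_def B_def indicator_def)
      have g: "g i \<omega> = ennreal (S (Suc i) \<omega>) * indicator {i. D i \<omega> < k \<and> k \<le> D (Suc i) \<omega>} i" for i
        using \<omega> by (auto simp: g_def G_def indicator_def)
      obtain l' where l': "(\<lambda>n. f n \<omega>) \<longlonglongrightarrow> l'"
        "(\<Sum>i. g i \<omega>) + l' \<le> ennreal (value_at (\<lambda>n. S n \<omega>) (drop_time (\<lambda>n. S n \<omega>) k))"
        using truncated_path_limit[of "\<lambda>n. S n \<omega>" k a] S_pos[OF \<omega>] k unfolding f g by blast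
      moreover have "l \<omega> = l'" unfolding l_def by (rule lim_imp_Limsup[OF _ l'(1)]) simp
      ultimately show ?thesis by simp
    qed
    have "ennreal x = (\<Sum>i<n. emeasure (Q (Suc i)) (G i)) + emeasure (Q n) (B n) + emeasure (Q n) (V n)" for n
    proof -
      have "{\<omega> \<in> space M. D n \<omega> < k} = B n \<union> V n" by (auto simp: B_def V_def)
      moreover have "emeasure (Q n) (B n) + emeasure (Q n) (V n) = emeasure (Q n) (B n \<union> V n)"
      proof (rule plus_emeasure)
        show "B n \<inter> V n = {}" by (auto simp: B_def V_def)
      qed simp_all
      ultimately show ?thesis using optional_stopping[OF k, of n] by (simp add: G_def add.assoc)
    qed
    moreover have "(\<lambda>n. (\<Sum>i<n. emeasure (Q (Suc i)) (G i)) + emeasure (Q n) (B n) + emeasure (Q n) (V n))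
        \<longlonglongrightarrow> (\<Sum>i. emeasure (Q (Suc i)) (G i)) + (\<integral>\<^sup>+\<omega>. l \<omega> \<partial>M) + 0"
    proof (intro tendsto_add)
      show "(\<lambda>n. \<Sum>i<n. emeasure (Q (Suc i)) (G i)) \<longlonglongrightarrow> (\<Sum>i. emeasure (Q (Suc i)) (G i))"
        by (rule summable_LIMSEQ) simp
      have "(\<lambda>n. \<integral>\<^sup>+\<omega>. f n \<omega> \<partial>M) \<longlonglongrightarrow> (\<integral>\<^sup>+\<omega>. l \<omega> \<partial>M)"
      \<comment> \<open>The truncation at \<open>a\<close> supplies a constant bound, integrable
        because \<open>M\<close> is a probability measure.\<close>
      proof (rule nn_integral_dominated_convergence[where w = "\<lambda>_. ennreal a"])
        show "AE \<omega> in M. f n \<omega> \<le> ennreal a" for n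
          by (rule AE_I2) (auto simp: f_def B_def indicator_def intro: ennreal_leI)
        show "(\<integral>\<^sup>+\<omega>. ennreal a \<partial>M) < \<infinity>" by (simp add: emeasure_space_1)
        show "AE \<omega> in M. (\<lambda>n. f n \<omega>) \<longlonglongrightarrow> l \<omega>" using path by (intro AE_I2) auto
      qed measurable
      then show "(\<lambda>n. emeasure (Q n) (B n)) \<longlonglongrightarrow> (\<integral>\<^sup>+\<omega>. l \<omega> \<partial>M)"
        by (simp add: emeasure_Q f_def)
      show "(\<lambda>n. emeasure (Q n) (V n)) \<longlonglongrightarrow> 0"
        unfolding V_def by (rule mass_above_tendsto_0[OF drop \<epsilon>])
    qed
    ultimately have "ennreal x = (\<Sum>i. emeasure (Q (Suc i)) (G i)) + (\<integral>\<^sup>+\<omega>. l \<omega> \<partial>M)"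
      using LIMSEQ_unique[OF tendsto_const] by fastforce
    also have "(\<Sum>i. emeasure (Q (Suc i)) (G i)) = (\<integral>\<^sup>+\<omega>. (\<Sum>i. g i \<omega>) \<partial>M)"
      by (subst nn_integral_suminf) (simp_all add: emeasure_Q g_def[abs_def])
    also have "\<dots> + (\<integral>\<^sup>+\<omega>. l \<omega> \<partial>M) = (\<integral>\<^sup>+\<omega>. (\<Sum>i. g i \<omega>) + l \<omega> \<partial>M)"
      by (rule nn_integral_add[symmetric]) measurable
    also have "\<dots> \<le> (\<integral>\<^sup>+\<omega>. ennreal (value_at (\<lambda>n. S n \<omega>) (drop_time (\<lambda>n. S n \<omega>) k)) \<partial>M)"
      using path by (intro nn_integral_mono) auto
    finally show ?thesis .
  qed
  then show ?thesis by (auto simp: bubble_def nn_integral_S_0 not_less)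
qed

end

theorem proposition2p1:
  fixes K :: "real \<Rightarrow> real measure"
  assumes "martingale_kernel K"
    and "Liminf at_top (\<lambda>x. ereal (drop_mean K x)) > 0"
  shows "\<And>(x::real) (M :: 'w measure) (S :: nat \<Rightarrow> 'w \<Rightarrow> real).
           x > 0 \<Longrightarrow> markov_chain M pos_borel K x S \<Longrightarrow> \<not> bubble M S"
proof -
  fix x :: real and M :: "'w measure" and S :: "nat \<Rightarrow> 'w \<Rightarrow> real"
  assume "markov_chain M pos_borel K x S"
  then interpret martingale_chain K M x S
    using assms(1) by unfold_locales
  obtain c where c: "0 < c" "c < Liminf at_top (\<lambda>x. ereal (drop_mean K x))"
    using dense[OF assms(2)] by blast
  then obtain r where r: "c = ereal r" by (cases c) auto
  have "\<forall>\<^sub>F s in at_top. r < drop_mean K s"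
    using less_LiminfD[OF c(2)] r by simp
  then obtain a where a: "\<And>s. s \<ge> a \<Longrightarrow> r < drop_mean K s"
    by (auto simp: eventually_at_top_linorder)
  show "\<not> bubble M S"
  proof (rule not_bubble)
    \<comment> \<open>The cap at 1/2 keeps the contraction factor \<open>1 - \<epsilon>\<close>
      positive.\<close>
    show "min r (1/2) \<le> drop_mean K s" if "s > a" for s using a[of s] that by simp
    show "0 < min r (1/2)" "min r (1/2) < 1" using c r by auto
  qed
qed

end
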